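(* Let $\sigma=\sigma_1\sigma_2\cdots\sigma_k$ be a permutation of length $k\ge 2$ and let $\hat\sigma=\sigma_2\sigma_1\sigma_3\cdots\sigma_k$. Then the map $\pi\mapsto\mathcal{S}^{\sigma,\hat\sigma}(\pi)$ is a bijection from the set $\mathrm{Sort}(\sigma,\hat\sigma)$ of $(\sigma,\hat\sigma)$-sortable permutations to the set $\mathfrak{S}(231)$ of $231$-avoiding permutations. More precisely, each $(\sigma,\hat\sigma)$-sortable permutation $\pi$ is obtained uniquely from a $231$-avoiding permutation $\alpha$ as $$\pi=\mathcal{R}\bigl(\mathcal{S}^{\sigma,\hat\sigma}(\mathcal{R}(\alpha))\bigr).$$ Consequently, for each $n\ge 1$ the number of $(\sigma,\hat\sigma)$-sortable permutations of length $n$ is the $n$-th Catalan number $\frac{1}{n+1}\binom{2n}{n}$.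
   Context: A permutation avoids $231$ if none of its subsequences is order isomorphic to $231$. $\mathcal{R}$ denotes the reverse: $\mathcal{R}(\pi_1\cdots\pi_n)=\pi_n\cdots\pi_1$. For a set $\Sigma$ of permutations of length at least $2$, the $\Sigma$-stack acts on an input permutation $\pi=\pi_1\cdots\pi_n$ as follows (starting with empty stack and output). For $i=1,\dots,n$: as long as pushing $\pi_i$ on top of the stack would make the content of the stack, read from top to bottom, contain an occurrence of some $\sigma\in\Sigma$ (a subsequence order isomorphic to $\sigma$), pop the top element and append it to the output; then push $\pi_i$. After all letters have been pushed, pop all remaining elements, from top to bottom, appending them to the output. The resulting output is denoted $\mathcal{S}^{\Sigma}(\pi)$. The permutation $\pi$ of length $n$ is $\Sigma$-sortable if $\mathcal{S}^{21}(\mathcal{S}^{\Sigma}(\pi))=12\cdots n$, where $\mathcal{S}^{21}=\mathcal{S}^{\{21\}}$. For $\Sigma=\{\sigma,\tau\}$ one writes $\mathcal{S}^{\sigma,\tau}$ and $(\sigma,\tau)$-sortable. *)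

theory Defs
  imports Complex_Main "HOL-Library.Sublist" "HOL-Combinatorics.Multiset_Permutations"
begin

text \<open>
  Permutations of length \<open>n\<close> are written in one-line notation, as lists containing each of
  \<open>1, \<dots>, n\<close> exactly once.
\<close>

definition perms :: "nat \<Rightarrow> nat list set" where
  "perms n = permutations_of_set {1..n}"

definition is_perm :: "nat list \<Rightarrow> bool" where
  "is_perm p \<longleftrightarrow> p \<in> perms (length p)"

definition order_isomorphic :: "nat list \<Rightarrow> nat list \<Rightarrow> bool" where
  "order_isomorphic xs ys \<longleftrightarrow> length xs = length ys \<and>
     (\<forall>i < length xs. \<forall>j < length xs. xs ! i < xs ! j \<longleftrightarrow> ys ! i < ys ! j)"

definition contains_pattern :: "nat list \<Rightarrow> nat list \<Rightarrow> bool" where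
  "contains_pattern xs s \<longleftrightarrow> (\<exists>ys. subseq ys xs \<and> order_isomorphic ys s)"

definition avoiders :: "nat list \<Rightarrow> nat list set" where
  "avoiders s = {p. is_perm p \<and> \<not> contains_pattern p s}"

text \<open>
  \<open>stack_run \<Sigma> xs st\<close> is the output still to be produced when \<open>xs\<close> is the remaining input and
  \<open>st\<close> is the stack, read from top to bottom. A letter is always pushed onto an empty stack,
  because the patterns in \<open>\<Sigma>\<close> have length at least two.
\<close>

fun stack_run :: "nat list set \<Rightarrow> nat list \<Rightarrow> nat list \<Rightarrow> nat list" where
  "stack_run \<Sigma> [] st = st"
| "stack_run \<Sigma> (x # xs) [] = stack_run \<Sigma> xs [x]"
| "stack_run \<Sigma> (x # xs) (t # st) =
     (if \<exists>s\<in>\<Sigma>. contains_pattern (x # t # st) s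
      then t # stack_run \<Sigma> (x # xs) st
      else stack_run \<Sigma> xs (x # t # st))"

definition stack_map :: "nat list set \<Rightarrow> nat list \<Rightarrow> nat list" where
  "stack_map \<Sigma> p = stack_run \<Sigma> p []"

definition sortable :: "nat list set \<Rightarrow> nat list set" where
  "sortable \<Sigma> = {p. is_perm p \<and> stack_map {[2, 1]} (stack_map \<Sigma> p) = [1..<Suc (length p)]}"

fun swap_first_two :: "nat list \<Rightarrow> nat list" where
  "swap_first_two (a # b # xs) = b # a # xs"
| "swap_first_two xs = xs"

end

theory Submission
  imports Defs
begin

text \<open>
  Let \<open>S\<close> be the stack map of a set of patterns of length at least two that is closed under
  swapping the first two letters. It is invertible on all words, and its inverse is its conjugate
  by reversal (\<open>rev_stack_map_rev_stack_map\<close>). To see this, play a run backwards: the output is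
  read from its end, pops become pushes and pushes become pops. Undoing a pop is a legal push,
  because the stack never contains a pattern. Undoing the push of a letter \<open>x\<close> must be a forced
  pop: if \<open>y\<close> is the last letter that left the stack before, then \<open>y\<close> was expelled by some letter
  \<open>x'\<close>, so \<open>x'\<close>, \<open>y\<close> and the letters below them contain a pattern, which has to use both \<open>x'\<close> and
  \<open>y\<close> as its first two letters (\<open>contains_pattern_swap\<close>). Exchanging these two letters gives
  another forbidden pattern, and so \<open>y\<close> cannot enter the stack in the backward run before \<open>x'\<close>,
  and hence everything above it, has left. If no letter left the stack before \<open>x\<close> was pushed, the
  backward run has no input left and empties its stack.

  By Knuth's theorem (\<open>sorted_stack_run_21_iff\<close>), a permutation is therefore sortable iff its image
  under \<open>S\<close> avoids 231, so that \<open>S\<close> restricts to a bijection from the sortable permutations to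
  the 231-avoiding ones.

  The 231-avoiding words with distinct letters are counted by a generating tree. A new smallest letter may be
  inserted in a 231-avoiding word precisely at the places where only descents precede it; if the
  longest decreasing prefix has length \<open>d\<close>, there are \<open>d + 1\<close> such places, and the resulting words
  have decreasing prefixes of length \<open>1, \<dots>, d + 1\<close> (\<open>sum_av231_insert\<close>). The number of
  descendants in this tree is a ballot number, a difference of two binomial coefficients.
\<close>

section \<open>Inverting the stack map\<close>

lemma contains_pattern_mono:
  "contains_pattern xs s \<Longrightarrow> subseq xs ys \<Longrightarrow> contains_pattern ys s"
  unfolding contains_pattern_def using subseq_order.trans by blast

lemma length_le_of_contains_pattern: "contains_pattern xs s \<Longrightarrow> length s \<le> length xs"
  unfolding contains_pattern_def order_isomorphic_def using list_emb_length by fastforce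

lemma order_isomorphic_swap:
  assumes "order_isomorphic (x # y # zs) (a # b # s)"
  shows "order_isomorphic (y # x # zs) (b # a # s)"
  using assms by (auto simp: order_isomorphic_def All_less_Suc2)

text \<open>
  The point of the hypotheses is that every occurrence in \<open>x # y # st\<close> starts with both \<open>x\<close> and
  \<open>y\<close>; in particular \<open>s\<close> has at least two letters.
\<close>

lemma contains_pattern_swap:
  assumes "contains_pattern (x # y # st) s"
    and "\<not> contains_pattern (x # st) s" "\<not> contains_pattern (y # st) s"
  shows "contains_pattern (y # x # st) (swap_first_two s)"
proof -
  obtain ys where ys: "subseq ys (x # y # st)" "order_isomorphic ys s"
    using assms(1) by (auto simp: contains_pattern_def)
  have "\<not> subseq ys (x # st)" "\<not> subseq ys (y # st)"
    using assms(2,3) ys(2) by (auto simp: contains_pattern_def)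
  then obtain zs where zs: "ys = x # y # zs" "subseq zs st"
    using ys(1) by (auto elim!: list_emb.cases[of _ ys] list_emb.cases[of _ _ "y # st"])
  then obtain a b s' where s: "s = a # b # s'"
    using ys(2) by (auto simp: order_isomorphic_def length_Suc_conv eq_commute[of "Suc _"])
  have "order_isomorphic (y # x # zs) (swap_first_two s)"
    using ys(2) unfolding zs(1) s by (simp add: order_isomorphic_swap)
  then show ?thesis
    using zs(2) unfolding contains_pattern_def by (meson subseq_Cons2)
qed

definition blocked :: "nat list set \<Rightarrow> nat list \<Rightarrow> bool" where
  "blocked \<Sigma> xs \<longleftrightarrow> (\<exists>s\<in>\<Sigma>. contains_pattern xs s)"

lemma blocked_mono: "blocked \<Sigma> xs \<Longrightarrow> subseq xs ys \<Longrightarrow> blocked \<Sigma> ys"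
  unfolding blocked_def using contains_pattern_mono by blast

lemma stack_run_Cons_Cons:
  "stack_run \<Sigma> (x # xs) (t # st) =
     (if blocked \<Sigma> (x # t # st) then t # stack_run \<Sigma> (x # xs) st
      else stack_run \<Sigma> xs (x # t # st))"
  by (simp add: blocked_def)

lemma stack_run_push: "\<not> blocked \<Sigma> (x # st) \<Longrightarrow> stack_run \<Sigma> (x # xs) st = stack_run \<Sigma> xs (x # st)"
  by (cases st) (simp_all add: blocked_def)

lemma stack_run_push_all:
  "\<not> blocked \<Sigma> st \<Longrightarrow> stack_run \<Sigma> (rev st @ xs) [] = stack_run \<Sigma> xs st"
proof (induction st arbitrary: xs)
  case (Cons t st)
  moreover from Cons.prems have "\<not> blocked \<Sigma> st"
    using blocked_mono by (metis list_emb_Cons subseq_order.refl)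
  ultimately show ?case by (simp add: stack_run_push)
qed simp

lemma mset_stack_run: "mset (stack_run \<Sigma> xs st) = mset xs + mset st"
  by (induction \<Sigma> xs st rule: stack_run.induct) simp_all

lemma mset_stack_map: "mset (stack_map \<Sigma> p) = mset p"
  by (simp add: stack_map_def mset_stack_run)

text \<open>
  In the middle of a run, let \<open>ro\<close> be the reversed output so far, \<open>st\<close> the stack and \<open>xs\<close> the
  remaining input. The backward run that starts from the complete output has to reach the stack
  \<open>st\<close> with \<open>ro\<close> left to read, after having put out \<open>rev xs\<close>. The last assumption is the
  invariant that forces the backward pops: the latest letter \<open>y\<close> of the output cannot enter the
  stack again, either right now or, directly after it has been expelled by the next input letter
  \<open>x\<close>, as soon as \<open>x\<close> has been pushed.
\<close>

lemma stack_run_rev_stack_run: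
  assumes "\<And>s. s \<in> \<Sigma> \<Longrightarrow> 2 \<le> length s" "\<And>s. s \<in> \<Sigma> \<Longrightarrow> swap_first_two s \<in> \<Sigma>"
    and "\<not> blocked \<Sigma> st"
    and "\<And>y ro'. ro = y # ro' \<Longrightarrow>
           blocked \<Sigma> (y # st) \<or> (\<exists>x xs'. xs = x # xs' \<and> blocked \<Sigma> (x # y # st))"
  shows "stack_run \<Sigma> (rev (stack_run \<Sigma> xs st) @ ro) [] = rev xs @ stack_run \<Sigma> ro st"
  using assms
proof (induction \<Sigma> xs st arbitrary: ro rule: stack_run.induct)
  case (1 \<Sigma> st)
  then show ?case by (simp add: stack_run_push_all)
next
  case (2 \<Sigma> x xs)
  have short: "\<not> blocked \<Sigma> [u]" for u
    using 2(2) length_le_of_contains_pattern by (fastforce simp: blocked_def)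
  have pop: "blocked \<Sigma> [y, x]" if "ro = y # ro'" for y ro'
  proof -
    have "blocked \<Sigma> [x, y]"
      using 2(5)[OF that] short by auto
    then obtain s where "s \<in> \<Sigma>" "contains_pattern [x, y] s"
      by (auto simp: blocked_def)
    then show ?thesis
      using contains_pattern_swap[of x y "[]" s] short 2(3) by (auto simp: blocked_def)
  qed
  have "stack_run \<Sigma> (rev (stack_run \<Sigma> xs [x]) @ ro) [] = rev xs @ stack_run \<Sigma> ro [x]"
    using 2(1)[OF 2(2,3) short] pop by blast
  moreover have "stack_run \<Sigma> ro [x] = x # stack_run \<Sigma> ro []"
    using pop by (cases ro) (simp_all add: stack_run_Cons_Cons del: stack_run.simps(3))
  ultimately show ?case by simp
next
  case (3 \<Sigma> x xs t st)
  show ?case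
  proof (cases "blocked \<Sigma> (x # t # st)")
    case True
    have "\<not> blocked \<Sigma> st"
      using 3(5) blocked_mono by (metis list_emb_Cons subseq_order.refl)
    then have "stack_run \<Sigma> (rev (stack_run \<Sigma> (x # xs) st) @ t # ro) []
        = rev (x # xs) @ stack_run \<Sigma> (t # ro) st"
      using 3(1)[OF _ 3(3,4), of "t # ro"] True by (simp add: blocked_def)
    moreover have "stack_run \<Sigma> (t # ro) st = stack_run \<Sigma> ro (t # st)"
      using 3(5) by (rule stack_run_push)
    ultimately show ?thesis
      using True by (simp add: stack_run_Cons_Cons del: stack_run.simps(3))
  next
    case False
    have pop: "blocked \<Sigma> (y # x # t # st)" if ro: "ro = y # ro'" for y ro'
    proof (cases "blocked \<Sigma> (y # t # st)")
      case True
      then show ?thesis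
        by (rule blocked_mono) auto
    next
      case y: False
      then obtain s where s: "s \<in> \<Sigma>" "contains_pattern (x # y # t # st) s"
        using 3(6)[OF ro] by (auto simp: blocked_def)
      then have "contains_pattern (y # x # t # st) (swap_first_two s)"
        using y False by (intro contains_pattern_swap) (auto simp: blocked_def)
      with s(1) show ?thesis
        using 3(4) by (auto simp: blocked_def)
    qed
    have "stack_run \<Sigma> (rev (stack_run \<Sigma> xs (x # t # st)) @ ro) []
        = rev xs @ stack_run \<Sigma> ro (x # t # st)"
      using 3(2)[OF _ 3(3,4) False, of ro] False pop by (auto simp: blocked_def)
    moreover have "stack_run \<Sigma> ro (x # t # st) = x # stack_run \<Sigma> ro (t # st)"
      using pop by (cases ro) (simp_all add: stack_run_Cons_Cons del: stack_run.simps(3))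
    ultimately show ?thesis
      using False by (simp add: stack_run_Cons_Cons del: stack_run.simps(3))
  qed
qed

theorem rev_stack_map_rev_stack_map:
  assumes "\<And>s. s \<in> \<Sigma> \<Longrightarrow> 2 \<le> length s" "\<And>s. s \<in> \<Sigma> \<Longrightarrow> swap_first_two s \<in> \<Sigma>"
  shows "rev (stack_map \<Sigma> (rev (stack_map \<Sigma> p))) = p"
proof -
  have "\<not> blocked \<Sigma> []"
    using assms(1) length_le_of_contains_pattern by (fastforce simp: blocked_def)
  then show ?thesis
    using stack_run_rev_stack_run[OF assms, of "[]" "[]" p] by (simp add: stack_map_def)
qed

section \<open>Sorting with a classical stack\<close>

text \<open>The simplifier would otherwise turn the letter 1 of the patterns into \<open>Suc 0\<close>.\<close>

declare One_nat_def [simp del]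

lemma set_mono_subseq: "subseq xs ys \<Longrightarrow> set xs \<subseteq> set ys"
  by (auto elim: list_emb_set)

lemma subseq_pair_Cons_iff:
  "subseq [a, b] (x # xs) \<longleftrightarrow> a = x \<and> b \<in> set xs \<or> subseq [a, b] xs"
  by (auto simp: subseq_singleton_left dest: set_mono_subseq)

lemma sorted_wrt_iff_subseq: "sorted_wrt R xs \<longleftrightarrow> (\<forall>a b. subseq [a, b] xs \<longrightarrow> R a b)"
proof (induction xs)
  case (Cons x xs)
  then show ?case
    unfolding subseq_pair_Cons_iff by auto
qed simp

lemma contains_pattern_21_iff: "contains_pattern xs [2, 1] \<longleftrightarrow> \<not> sorted xs"
proof -
  have "order_isomorphic [b, a] [2, 1] \<longleftrightarrow> a < b" for b a
    unfolding order_isomorphic_def by (auto simp: All_less_Suc2)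
  moreover have "\<exists>b a. ys = [b, a]" if "order_isomorphic ys [2, 1]" for ys
    using that by (auto simp: order_isomorphic_def length_Suc_conv)
  ultimately have "order_isomorphic ys [2, 1] \<longleftrightarrow> (\<exists>b a. ys = [b, a] \<and> a < b)" for ys
    by metis
  then show ?thesis
    by (auto simp: contains_pattern_def sorted_wrt_iff_subseq not_le)
qed

definition has231 :: "nat list \<Rightarrow> bool" where
  "has231 xs \<longleftrightarrow> (\<exists>b c a. subseq [b, c, a] xs \<and> a < b \<and> b < c)"

lemma contains_pattern_231_iff: "contains_pattern xs [2, 3, 1] \<longleftrightarrow> has231 xs"
proof -
  have "order_isomorphic [b, c, a] [2, 3, 1] \<longleftrightarrow> a < b \<and> b < c" for b c a
    unfolding order_isomorphic_def by (auto simp: All_less_Suc2)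
  moreover have "\<exists>b c a. ys = [b, c, a]" if "order_isomorphic ys [2, 3, 1]" for ys
    using that by (auto simp: order_isomorphic_def length_Suc_conv)
  ultimately have "order_isomorphic ys [2, 3, 1] \<longleftrightarrow> (\<exists>b c a. ys = [b, c, a] \<and> a < b \<and> b < c)"
    for ys
    by metis
  then show ?thesis
    by (auto simp: contains_pattern_def has231_def)
qed

lemma has231_mono: "has231 xs \<Longrightarrow> subseq xs ys \<Longrightarrow> has231 ys"
  unfolding has231_def using subseq_order.trans by blast

text \<open>
  Knuth's theorem, for a run that is under way. The letters on the stack behave as if they were
  still in front of the input: being decreasing, they can only play the role of the 2.
\<close>

lemma sorted_stack_run_21_iff:
  "sorted st \<Longrightarrow> sorted (stack_run {[2, 1]} xs st) \<longleftrightarrow> \<not> has231 (rev st @ xs)"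
proof (induction "{[2 :: nat, 1]}" xs st rule: stack_run.induct)
  case (1 st)
  have "\<not> b < c" if "subseq [b, c, a] (rev st)" for a b c
  proof -
    have "subseq [b, c] (rev st)"
      using that by (rule subseq_order.trans[rotated]) simp
    then show ?thesis
      using 1 sorted_wrt_iff_subseq[of "(\<ge>)" "rev st"] by (simp add: sorted_wrt_rev not_less)
  qed
  then show ?case
    using 1 by (auto simp: has231_def)
next
  case (2 x xs)
  then show ?case by simp
next
  case (3 x xs t st)
  show ?case
  proof (cases "sorted (x # t # st)")
    case True
    then show ?thesis
      using 3(2) by (simp add: contains_pattern_21_iff)
  next
    case False
    then have tx: "t < x" and t: "\<And>u. u \<in> set st \<Longrightarrow> t \<le> u" and st: "sorted st"
      using 3(3) by auto
    \<comment> \<open>The letter \<open>t\<close> leaves because of the larger \<open>x\<close>. It leaves too early iff a smaller letter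
      is still to come, and this letter completes \<open>t\<close> and \<open>x\<close> to a 231.\<close>
    have "has231 (rev st @ t # x # xs) \<longleftrightarrow>
        (\<exists>a\<in>set xs. a < t) \<or> has231 (rev st @ x # xs)" (is "?L \<longleftrightarrow> ?R1 \<or> ?R2")
    proof
      assume ?L
      then obtain b c a where bca: "subseq [b, c, a] (rev st @ t # x # xs)" "a < b" "b < c"
        by (auto simp: has231_def)
      have desc: "v \<le> u" if "subseq [u, v] (rev st @ [t])" for u v
      proof -
        have "sorted_wrt (\<ge>) (rev (t # st))"
          using 3(3) by (simp only: sorted_wrt_rev)
        then show ?thesis
          using that by (simp add: sorted_wrt_iff_subseq)
      qed
      obtain us vs where uv: "[b, c, a] = us @ vs" "subseq us (rev st @ [t])" "subseq vs (x # xs)"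
        using bca(1) subseq_append_iff[of "[b, c, a]" "rev st @ [t]" "x # xs"] by auto
      then consider "us = []" | "us = [b]" "vs = [c, a]" | ws where "us = b # c # ws"
        by (auto simp: Cons_eq_append_conv)
      then show "?R1 \<or> ?R2"
      proof cases
        case 1
        then have "subseq [b, c, a] (rev st @ x # xs)"
          using uv by (metis append_Nil list_emb_append2)
        with bca show ?thesis by (auto simp: has231_def)
      next
        case 2
        then have ca: "subseq [c, a] (x # xs)" and "b \<in> set st \<or> b = t"
          using uv by (auto simp: subseq_singleton_left)
        then show ?thesis
        proof (elim disjE)
          assume "b \<in> set st"
          then have "subseq ([b] @ [c, a]) (rev st @ x # xs)"
            using ca by (intro list_emb_append_mono) (auto simp: subseq_singleton_left)
          with bca show ?thesis by (auto simp: has231_def)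
        next
          assume "b = t"
          then have "a \<in> set xs"
            using ca bca tx by (auto simp: subseq_singleton_left dest: set_mono_subseq split: if_splits)
          with bca \<open>b = t\<close> show ?thesis by auto
        qed
      next
        case 3
        then have "subseq [b, c] us" by simp
        then have "subseq [b, c] (rev st @ [t])"
          using uv(2) by (rule subseq_order.trans)
        with desc bca show ?thesis by fastforce
      qed
    next
      assume "?R1 \<or> ?R2"
      then show ?L
      proof
        assume ?R1
        then obtain a where "a \<in> set xs" "a < t" by auto
        then have "subseq [t, x, a] (rev st @ t # x # xs)"
          by (intro list_emb_append2) (simp add: subseq_singleton_left)
        with \<open>a < t\<close> tx show ?L by (auto simp: has231_def)
      next
        assume ?R2
        then show ?L
          by (rule has231_mono) (auto intro!: list_emb_append_mono)
      qed
    qed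
    moreover have "set (stack_run {[2, 1]} (x # xs) st) = insert x (set xs \<union> set st)"
      by (metis list.set(2) mset_stack_run set_mset_mset set_mset_union Un_insert_left)
    ultimately show ?thesis
      using 3(1) False st tx t by (auto simp: contains_pattern_21_iff not_less less_imp_le)
  qed
qed

lemma is_perm_iff: "is_perm p \<longleftrightarrow> mset p = mset [1..<Suc (length p)]"
proof -
  have "is_perm p \<longleftrightarrow> set p = set [1..<Suc (length p)] \<and> distinct p"
    unfolding is_perm_def perms_def permutations_of_set_def
    by (simp add: atLeastLessThanSuc_atLeastAtMost del: upt_Suc)
  also have "\<dots> \<longleftrightarrow> mset p = mset [1..<Suc (length p)]"
    by (metis distinct_upt mset_eq_imp_distinct_iff mset_eq_setD set_eq_iff_mset_eq_distinct)
  finally show ?thesis .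
qed

lemma sortable_iff: "p \<in> sortable \<Sigma> \<longleftrightarrow> is_perm p \<and> \<not> has231 (stack_map \<Sigma> p)"
proof -
  let ?q = "stack_map {[2, 1]} (stack_map \<Sigma> p)"
  have "?q = [1..<Suc (length p)] \<longleftrightarrow> sorted ?q" if "is_perm p"
  proof
    show "?q = [1..<Suc (length p)] \<Longrightarrow> sorted ?q" by (metis sorted_upt)
  next
    assume "sorted ?q"
    moreover have "mset ?q = mset [1..<Suc (length p)]"
      using that by (simp only: mset_stack_map is_perm_iff)
    ultimately show "?q = [1..<Suc (length p)]"
      by (metis properties_for_sort sorted_upt)
  qed
  then show ?thesis
    using sorted_stack_run_21_iff[of "[]" "stack_map \<Sigma> p"]
    by (auto simp: sortable_def stack_map_def[of "{[2, 1]}"])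
qed

lemma avoiders_231_iff: "p \<in> avoiders [2, 3, 1] \<longleftrightarrow> is_perm p \<and> \<not> has231 p"
  by (simp add: avoiders_def contains_pattern_231_iff)

section \<open>Counting 231-avoiding words\<close>

fun desc_run :: "nat list \<Rightarrow> nat" where
  "desc_run [] = 0"
| "desc_run [x] = 1"
| "desc_run (x # y # zs) = (if y < x then Suc (desc_run (y # zs)) else 1)"

lemma desc_run_le_length: "desc_run xs \<le> length xs"
  by (induction xs rule: desc_run.induct) auto

lemma sorted_wrt_take_iff_le_desc_run:
  "p \<le> length xs \<Longrightarrow> sorted_wrt (>) (take p xs) \<longleftrightarrow> p \<le> desc_run xs"
proof (induction xs arbitrary: p rule: desc_run.induct)
  case (2 x)
  then show ?case by (cases p) auto
next
  case (3 x y zs)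
  show ?case
  proof (cases p)
    case (Suc q)
    show ?thesis
    proof (cases q)
      case (Suc r)
      have "sorted_wrt (>) (take p (x # y # zs)) \<longleftrightarrow> y < x \<and> sorted_wrt (>) (take q (y # zs))"
        unfolding \<open>p = Suc q\<close> Suc take_Suc_Cons by (rule sorted_wrt2[OF transp_on_greater])
      then show ?thesis
        using 3 \<open>p = Suc q\<close> Suc by (simp del: sorted_wrt.simps take_Suc_Cons)
    qed (use Suc in auto)
  qed auto
qed auto

lemma desc_run_insert_min:
  "sorted_wrt (>) us \<Longrightarrow> \<forall>z\<in>set us \<union> set vs. m < z \<Longrightarrow> desc_run (us @ m # vs) = Suc (length us)"
proof (induction us rule: desc_run.induct)
  case 1
  then show ?case by (cases vs) auto
next
  case (2 x)
  then show ?case by (cases vs) auto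
qed auto

lemma subseq_snoc_appendD:
  "x \<notin> set vs \<Longrightarrow> subseq (ws @ [x]) (us @ x # vs) \<Longrightarrow> subseq ws us"
proof (induction us arbitrary: ws)
  case Nil
  show ?case
  proof (cases ws)
    case (Cons w ws')
    have "x \<in> set vs" if "subseq (zs @ [x]) vs" for zs
      using set_mono_subseq[OF that] by simp
    with Nil Cons show ?thesis
      by (metis append_Cons append_Nil list_emb_Cons_iff1 list_emb_Cons_iff2)
  qed simp
next
  case (Cons u us)
  show ?case
  proof (cases ws)
    case (Cons w ws')
    then show ?thesis
      using Cons.IH[of ws'] Cons.IH[of ws] Cons.prems by (cases "w = u") simp_all
  qed simp
qed

text \<open>
  The smallest letter can only be the 1 of an occurrence of 231, with any ascent of \<open>us\<close> as 23.
\<close>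

lemma has231_insert_min_iff:
  assumes m: "\<forall>z\<in>set us \<union> set vs. m < z" and "distinct us"
  shows "has231 (us @ m # vs) \<longleftrightarrow> \<not> sorted_wrt (>) us \<or> has231 (us @ vs)"
proof
  assume "has231 (us @ m # vs)"
  then obtain b c a where bca: "subseq [b, c, a] (us @ m # vs)" "a < b" "b < c"
    by (auto simp: has231_def)
  have "set [b, c, a] \<subseteq> set (us @ m # vs)"
    using bca(1) by (rule set_mono_subseq)
  then have "a \<in> set (us @ m # vs)" by simp
  then have "a = m \<or> m < a" using m by auto
  with bca have "b \<noteq> m" "c \<noteq> m" by auto
  show "\<not> sorted_wrt (>) us \<or> has231 (us @ vs)"
  proof (cases "a = m")
    case True
    have "m \<notin> set vs" using m by auto
    moreover have "subseq ([b, c] @ [m]) (us @ m # vs)"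
      using bca(1) True by simp
    ultimately have "subseq [b, c] us" by (rule subseq_snoc_appendD)
    with bca(3) have "\<not> sorted_wrt (>) us"
      unfolding sorted_wrt_iff_subseq by (meson not_less_iff_gr_or_eq)
    then show ?thesis ..
  next
    case False
    have "subseq (filter (\<lambda>z. z \<noteq> m) [b, c, a]) (filter (\<lambda>z. z \<noteq> m) (us @ m # vs))"
      using bca(1) by (rule subseq_filter)
    moreover have "filter (\<lambda>z. z \<noteq> m) us = us" "filter (\<lambda>z. z \<noteq> m) vs = vs"
      using m by (auto simp: filter_id_conv)
    ultimately have "subseq [b, c, a] (us @ vs)"
      using False \<open>b \<noteq> m\<close> \<open>c \<noteq> m\<close> by simp
    with bca show ?thesis unfolding has231_def by blast
  qed
next
  assume "\<not> sorted_wrt (>) us \<or> has231 (us @ vs)"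
  then show "has231 (us @ m # vs)"
  proof
    assume "\<not> sorted_wrt (>) us"
    then obtain b c where bc: "subseq [b, c] us" "\<not> c < b"
      unfolding sorted_wrt_iff_subseq by blast
    have "distinct [b, c]"
      using bc(1) \<open>distinct us\<close> by (metis distinct_nthsI subseq_conv_nths)
    with bc(2) have "b < c" by simp
    have "b \<in> set us" using set_mono_subseq[OF bc(1)] by simp
    then have "m < b" using m by blast
    have "subseq ([b, c] @ [m]) (us @ m # vs)"
      using bc(1) by (intro list_emb_append_mono) simp_all
    with \<open>m < b\<close> \<open>b < c\<close> show ?thesis
      unfolding has231_def append_Cons append_Nil by blast
  next
    assume "has231 (us @ vs)"
    then show ?thesis
      by (rule has231_mono) (auto intro!: list_emb_append_mono)
  qed
qed

definition av231 :: "nat set \<Rightarrow> nat list set" where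
  "av231 A = {xs \<in> permutations_of_set A. \<not> has231 xs}"

lemma finite_av231 [simp]: "finite A \<Longrightarrow> finite (av231 A)"
  by (simp add: av231_def)

text \<open>
  The children of \<open>xs\<close> in the generating tree arise by inserting \<open>m\<close> after any \<open>p\<close> letters of its
  decreasing prefix, and \<open>m\<close> then ends a decreasing prefix of length \<open>p + 1\<close>. A weight \<open>g\<close> that
  depends on this length only is used instead of a mere count, so that the step can be iterated.
\<close>

lemma sum_av231_insert:
  fixes g :: "nat \<Rightarrow> nat"
  assumes "finite A" and m: "\<forall>z\<in>A. m < z"
  shows "(\<Sum>ys\<in>av231 (insert m A). g (desc_run ys)) =
    (\<Sum>xs\<in>av231 A. \<Sum>d = 1..Suc (desc_run xs). g d)"
proof -
  let ?I = "SIGMA xs:av231 A. {..desc_run xs}"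
  let ?ins = "\<lambda>(xs, p). take p xs @ m # drop p xs"
  have "m \<notin> A" using m by auto
  have ins: "?ins (xs, p) \<in> av231 (insert m A)" "desc_run (?ins (xs, p)) = Suc p"
    if "xs \<in> av231 A" "p \<le> desc_run xs" for xs p
  proof -
    have xs: "set xs = A" "distinct xs" "\<not> has231 xs"
      using that by (auto simp: av231_def permutations_of_set_def)
    have p: "p \<le> length xs" using that(2) desc_run_le_length order_trans by blast
    with that(2) have desc: "sorted_wrt (>) (take p xs)"
      by (simp add: sorted_wrt_take_iff_le_desc_run)
    have "set (take p xs) \<union> set (drop p xs) = A"
      by (metis append_take_drop_id set_append xs(1))
    then have min: "\<forall>z\<in>set (take p xs) \<union> set (drop p xs). m < z" using m by simp
    have "mset (take p xs @ m # drop p xs) = add_mset m (mset xs)"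
      by (metis append_take_drop_id mset.simps(2) mset_append union_mset_add_mset_right)
    then have "set (take p xs @ m # drop p xs) = insert m A" "distinct (take p xs @ m # drop p xs)"
      using xs \<open>m \<notin> A\<close> by (metis list.set(2) mset.simps(2) mset_eq_setD,
        metis distinct.simps(2) mset.simps(2) mset_eq_imp_distinct_iff)
    moreover have "\<not> has231 (take p xs @ m # drop p xs)"
      using desc xs has231_insert_min_iff[OF min] by simp
    ultimately show "?ins (xs, p) \<in> av231 (insert m A)"
      by (simp add: av231_def permutations_of_set_def)
    show "desc_run (?ins (xs, p)) = Suc p"
      using desc_run_insert_min[OF desc min] p by simp
  qed
  have bij: "bij_betw ?ins ?I (av231 (insert m A))"
  proof (rule bij_betwI')
    fix z z' assume z: "z \<in> ?I" "z' \<in> ?I"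
    obtain xs p xs' p' where [simp]: "z = (xs, p)" "z' = (xs', p')" by fastforce
    \<comment> \<open>Deleting \<open>m\<close> recovers the word, and the decreasing prefix tells the position.\<close>
    have "remove1 m (?ins (ws, q)) = ws" if "ws \<in> av231 A" for ws q
    proof -
      have "m \<notin> set ws" using that \<open>m \<notin> A\<close> by (auto simp: av231_def permutations_of_set_def)
      then have "m \<notin> set (take q ws)" using in_set_takeD by metis
      then show ?thesis by (simp add: remove1_append)
    qed
    then show "?ins z = ?ins z' \<longleftrightarrow> z = z'"
      using z ins(2) by (metis (no_types, lifting) SigmaE2 Suc_inject \<open>z = (xs, p)\<close>
          \<open>z' = (xs', p')\<close> atMost_iff)
  next
    fix z assume "z \<in> ?I"
    then show "?ins z \<in> av231 (insert m A)" using ins(1) by auto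
  next
    fix ys assume ys: "ys \<in> av231 (insert m A)"
    then have "m \<in> set ys" by (auto simp: av231_def permutations_of_set_def)
    then obtain us vs where uv: "ys = us @ m # vs" by (meson split_list)
    have d: "distinct ys" and "set ys = insert m A" "\<not> has231 ys"
      using ys by (auto simp: av231_def permutations_of_set_def)
    then have A: "set us \<union> set vs = A" using uv \<open>m \<notin> A\<close> by auto
    have "sorted_wrt (>) us" "\<not> has231 (us @ vs)"
      using has231_insert_min_iff[of us vs m] A m d uv \<open>\<not> has231 ys\<close> by auto
    moreover from this have "length us \<le> desc_run (us @ vs)"
      using sorted_wrt_take_iff_le_desc_run[of "length us" "us @ vs"] by simp
    ultimately have "(us @ vs, length us) \<in> ?I"
      using A d uv by (auto simp: av231_def permutations_of_set_def)
    then show "\<exists>z\<in>?I. ys = ?ins z" by (rule bexI[rotated]) (simp add: uv)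
  qed
  have "(\<Sum>ys\<in>av231 (insert m A). g (desc_run ys)) = (\<Sum>z\<in>?I. g (desc_run (?ins z)))"
    by (rule sum.reindex_bij_betw[OF bij, symmetric])
  also have "\<dots> = (\<Sum>(xs, p)\<in>?I. g (Suc p))"
    using ins(2) by (intro sum.cong) auto
  also have "\<dots> = (\<Sum>xs\<in>av231 A. \<Sum>p\<le>desc_run xs. g (Suc p))"
    using assms(1) by (simp add: sum.Sigma)
  also have "\<dots> = (\<Sum>xs\<in>av231 A. \<Sum>d = 1..Suc (desc_run xs). g d)"
    by (simp only: atMost_atLeast0 One_nat_def sum.shift_bounds_cl_Suc_ivl)
  finally show ?thesis .
qed

text \<open>
  \<open>descendants j d\<close> counts the nodes \<open>j\<close> levels below a node of label \<open>d\<close> in the tree in which a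
  node of label \<open>d\<close> has one child of each label \<open>1, \<dots>, d + 1\<close>.
\<close>

fun descendants :: "nat \<Rightarrow> nat \<Rightarrow> nat" where
  "descendants 0 d = 1"
| "descendants (Suc j) d = (\<Sum>e = 1..Suc d. descendants j e)"

text \<open>
  Removing smallest letters walks up the tree to the empty word, its root, which has label 0. The
  extra \<open>j\<close> levels are there for the induction; \<open>j = 0\<close> gives the number of words.
\<close>

lemma sum_descendants_av231:
  "finite A \<Longrightarrow> (\<Sum>xs\<in>av231 A. descendants j (desc_run xs)) = descendants (j + card A) 0"
proof (induction A arbitrary: j rule: finite_linorder_min_induct)
  case empty
  have "av231 {} = {[]}" by (auto simp: av231_def has231_def)
  then show ?case by simp
next
  case (insert m A)
  then have "m \<notin> A" by auto
  have "(\<Sum>ys\<in>av231 (insert m A). descendants j (desc_run ys))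
      = (\<Sum>xs\<in>av231 A. descendants (Suc j) (desc_run xs))"
    using insert.hyps by (simp only: sum_av231_insert descendants.simps)
  also have "\<dots> = descendants (j + card (insert m A)) 0"
    using insert.IH[of "Suc j"] insert.hyps(1) \<open>m \<notin> A\<close> by (simp del: descendants.simps)
  finally show ?case .
qed

text \<open>
  The ballot numbers. The number \<open>F j d\<close> of descendants and the difference of the two binomial
  coefficients both satisfy \<open>F (j + 1) 0 = F j 1\<close> and
  \<open>F (j + 1) (d + 1) = F (j + 1) d + F j (d + 2)\<close>, the latter by Pascal's rule.
\<close>

lemma descendants_closed_form:
  "descendants j d + ((2 * j + d) choose Suc (j + d)) = (2 * j + d) choose (j + d)"
proof (induction j arbitrary: d)
  case 0
  then show ?case by simp
next
  case (Suc j)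
  show ?case
  proof (induction d)
    case 0
    have "Suc (2 * j) choose j = Suc (2 * j) choose Suc j"
      using binomial_symmetric[of j "Suc (2 * j)"] by simp
    then show ?case
      using Suc.IH[of "Suc 0"] by (simp add: One_nat_def)
  next
    case d: (Suc d)
    have "descendants (Suc j) (Suc d) = descendants (Suc j) d + descendants j (d + 2)"
      by simp
    then show ?case
      using d Suc.IH[of "d + 2"] by simp
  qed
qed

lemma catalan_eq: "real (descendants n 0) = 1 / real (n + 1) * real ((2 * n) choose n)"
proof -
  have "Suc n * ((2 * n) choose Suc n) = n * ((2 * n) choose n)"
    using binomial_absorb_comp[of "2 * n" n] binomial_absorption[of n "2 * n"]
    by (simp only: mult_2 diff_add_inverse)
  then have "Suc n * descendants n 0 + n * ((2 * n) choose n) = Suc n * ((2 * n) choose n)"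
    by (metis add_0_right add_mult_distrib2 descendants_closed_form)
  then have "real (n + 1) * real (descendants n 0) = real ((2 * n) choose n)"
    by (simp add: algebra_simps flip: of_nat_mult of_nat_add)
  then show ?thesis by (simp add: field_simps)
qed

lemma card_avoiders_231:
  "real (card {\<alpha> \<in> avoiders [2, 3, 1]. length \<alpha> = n}) = 1 / real (n + 1) * real ((2 * n) choose n)"
proof -
  have "{\<alpha> \<in> avoiders [2, 3, 1]. length \<alpha> = n} = av231 {1..n}"
    by (auto simp: avoiders_231_iff av231_def is_perm_def perms_def
        length_finite_permutations_of_set)
  then show ?thesis
    using sum_descendants_av231[of "{1..n}" 0] by (simp add: catalan_eq)
qed

section \<open>Sortable permutations\<close>

lemma swap_first_two_swap_first_two: "swap_first_two (swap_first_two s) = s"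
  by (induction s rule: swap_first_two.induct) simp_all

lemma length_swap_first_two: "length (swap_first_two s) = length s"
  by (induction s rule: swap_first_two.induct) simp_all

theorem mainTheorem14:
  fixes \<sigma> :: "nat list" and k :: nat
  assumes "k \<ge> 2" and "\<sigma> \<in> perms k"
  defines "\<Sigma> \<equiv> {\<sigma>, swap_first_two \<sigma>}"
  shows "bij_betw (stack_map \<Sigma>) (sortable \<Sigma>) (avoiders [2, 3, 1]) \<and>
    (\<forall>\<pi> \<in> sortable \<Sigma>.
       (\<exists>!\<alpha>. \<alpha> \<in> avoiders [2, 3, 1] \<and> \<pi> = rev (stack_map \<Sigma> (rev \<alpha>))) \<and>
       \<pi> = rev (stack_map \<Sigma> (rev (stack_map \<Sigma> \<pi>)))) \<and>
    (\<forall>n \<ge> 1. real (card {\<pi> \<in> sortable \<Sigma>. length \<pi> = n}) =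
       1 / real (n + 1) * real ((2 * n) choose n))"
proof -
  let ?S = "stack_map \<Sigma>"
  have "length \<sigma> = k"
    using assms(2) length_finite_permutations_of_set by (fastforce simp: perms_def)
  then have left: "rev (?S (rev (?S p))) = p" for p
    using assms(1)
    by (intro rev_stack_map_rev_stack_map)
      (auto simp: \<Sigma>_def swap_first_two_swap_first_two length_swap_first_two)
  have right: "?S (rev (?S (rev p))) = p" for p
    using left[of "rev p"] by (metis rev_rev_ident)
  have len: "length (?S p) = length p" for p
    by (metis mset_stack_map size_mset)
  have perm: "is_perm (?S p) \<longleftrightarrow> is_perm p" "is_perm (rev p) \<longleftrightarrow> is_perm p" for p
    by (simp_all only: is_perm_iff mset_stack_map len mset_rev length_rev)
  have to: "?S \<pi> \<in> avoiders [2, 3, 1]" if "\<pi> \<in> sortable \<Sigma>" for \<pi>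
    using that by (simp add: sortable_iff avoiders_231_iff perm)
  have bij: "bij_betw ?S (sortable \<Sigma>) (avoiders [2, 3, 1])"
    by (rule bij_betw_byWitness[where f' = "\<lambda>\<alpha>. rev (?S (rev \<alpha>))"])
      (auto simp: left right to sortable_iff avoiders_231_iff perm)
  have "bij_betw ?S {\<pi> \<in> sortable \<Sigma>. length \<pi> = n} {\<alpha> \<in> avoiders [2, 3, 1]. length \<alpha> = n}" for n
    by (rule bij_betw_Collect[OF bij]) (simp add: len)
  then have "card {\<pi> \<in> sortable \<Sigma>. length \<pi> = n} = card {\<alpha> \<in> avoiders [2, 3, 1]. length \<alpha> = n}"
    for n by (rule bij_betw_same_card)
  moreover have "\<exists>!\<alpha>. \<alpha> \<in> avoiders [2, 3, 1] \<and> \<pi> = rev (?S (rev \<alpha>))" if "\<pi> \<in> sortable \<Sigma>" for \<pi>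
    using to[OF that] left right by metis
  ultimately show ?thesis
    using bij left by (simp add: card_avoiders_231)
qed

end
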